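(* Let $\{X,X_n;\,n\ge1\}$ be a sequence of non-negative i.i.d. random variables, $S_n=\sum_{i=1}^nX_i$, and let $$\bar\alpha=-\limsup_{t\to\infty}\frac1t\log\mathbb{P}(\log X>t),\qquad \underline\alpha=-\liminf_{t\to\infty}\frac1t\log\mathbb{P}(\log X>t).$$ (i) If $0<p<1$ and $\lim_{n\to\infty}n\mathbb{P}(X>n^{1/p})=0$, then for all $s>0$, $$\limsup_{n\to\infty}\frac{1}{\log n}\log\mathbb{P}(S_n>sn^{1/p})=-\frac{\bar\alpha-p}{p},\qquad \liminf_{n\to\infty}\frac{1}{\log n}\log\mathbb{P}(S_n>sn^{1/p})=-\frac{\underline\alpha-p}{p};$$ hence, for all $s>0$ and $\hat\alpha\in[0,\infty]$, $\lim_{n\to\infty}\frac{1}{\log n}\log\mathbb{P}(S_n>sn^{1/p})=-(\hat\alpha-p)/p$ iff $\bar\alpha=\underline\alpha=\hat\alpha$. (ii) If $1\le p<2$, $\mathbb{E}X=\mu\in(0,\infty)$ and $\lim_{n\to\infty}n\mathbb{P}(X>n^{1/p})=0$, then for all $s>0$, $$\limsup_{n\to\infty}\frac{1}{\log n}\log\mathbb{P}(S_n>n\mu+sn^{1/p})=-\frac{\bar\alpha-p}{p},\qquad \liminf_{n\to\infty}\frac{1}{\log n}\log\mathbb{P}(S_n>n\mu+sn^{1/p})=-\frac{\underline\alpha-p}{p};$$ hence, for all $s>0$ and $\hat\alpha\in[0,\infty]$, $\lim_{n\to\infty}\frac{1}{\log n}\log\mathbb{P}(S_n>n\mu+sn^{1/p})=-(\hat\alpha-p)/p$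 iff $\bar\alpha=\underline\alpha=\hat\alpha$.
   Context: Conventions: $\log 0=-\infty$ (so $\log X=-\infty$ when $X=0$); $(\pm\infty+y)/x=\pm\infty$ for $x\in(0,\infty)$, $y\in\mathbb{R}$. *)

theory Defs
  imports "HOL-Probability.Probability"
begin

definition elog :: "real \<Rightarrow> ereal" where
  "elog x = (if x = 0 then - \<infinity> else ereal (ln x))"

definition alpha_bar :: "'a measure \<Rightarrow> ('a \<Rightarrow> real) \<Rightarrow> ereal" where
  "alpha_bar M Y = - Limsup at_top
     (\<lambda>t::real. ereal (1 / t) * elog (measure M {\<omega> \<in> space M. elog (Y \<omega>) > ereal t}))"

definition alpha_under :: "'a measure \<Rightarrow> ('a \<Rightarrow> real) \<Rightarrow> ereal" where
  "alpha_under M Y = - Liminf at_top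
     (\<lambda>t::real. ereal (1 / t) * elog (measure M {\<omega> \<in> space M. elog (Y \<omega>) > ereal t}))"

definition psum :: "(nat \<Rightarrow> 'a \<Rightarrow> real) \<Rightarrow> nat \<Rightarrow> 'a \<Rightarrow> real" where
  "psum X n \<omega> = (\<Sum>i\<in>{1..n}. X i \<omega>)"

end

theory Submission
  imports Defs "HOL-Real_Asymp.Real_Asymp"
begin

text \<open>
  A single large summand is the cheapest way to a large sum. Fix \<open>c > 1\<close>. Truncating at
  \<open>n\<^bsup>1/(cp)\<^esup>\<close> and applying the exponential Markov inequality with parameter
  \<open>n\<^bsup>\<eta>-1/p\<^esup>\<close>, \<open>\<eta>\<close> small, the probability in question is at most
  \<open>n P(X > n\<^bsup>1/(cp)\<^esup>)\<close> up to a term that decays faster than any power of \<open>n\<close>. Conversely it is at least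
  \<open>n P(X > n\<^bsup>c/p\<^esup>) / 2\<close>, because one summand above \<open>n\<^bsup>c/p\<^esup>\<close> suffices as soon as the others
  do not fall short of their mean by \<open>n\<^bsup>c/p\<^esup> / 2\<close>. Neither rate of \<open>P(log X > t)\<close> notices the
  change of scale by \<open>c\<close> in the limit \<open>c \<rightarrow> 1\<close>; the slack also makes crude moment bounds of
  order \<open>q < p\<close> sufficient throughout.
\<close>

section \<open>Logarithmic rates of comparable sequences\<close>

lemma elog_divide_le_iff:
  assumes "0 \<le> x" "0 < w"
  shows "elog x / ereal w \<le> ereal z \<longleftrightarrow> x \<le> exp (w * z)"
proof (cases "x = 0")
  case True
  then show ?thesis using assms by (simp add: elog_def)
next
  case False
  then have "elog x / ereal w \<le> ereal z \<longleftrightarrow> ln x \<le> w * z"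
    using assms by (simp add: elog_def field_simps)
  then show ?thesis
    using False assms by (metis exp_le_cancel_iff exp_ln order_le_less)
qed

lemma le_elog_divide_iff:
  assumes "0 \<le> x" "0 < w"
  shows "ereal z \<le> elog x / ereal w \<longleftrightarrow> exp (w * z) \<le> x"
proof (cases "x = 0")
  case True
  then show ?thesis using assms by (simp add: elog_def not_le)
next
  case False
  then have "ereal z \<le> elog x / ereal w \<longleftrightarrow> w * z \<le> ln x"
    using assms by (simp add: elog_def field_simps)
  then show ?thesis
    using False assms by (metis exp_le_cancel_iff exp_ln order_le_less)
qed

text \<open>Exponents are compared later after a change of scale by some \<open>c > 1\<close>, and
  this supplies one that does not spoil a strict inequality. Only a negative \<open>b\<close> is
  delicate, since \<open>c * b\<close> then moves towards \<open>a\<close>.\<close>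

lemma ex_scale_gt:
  fixes a b :: real
  assumes "a < b"
  shows "\<exists>c>1. a < c * b"
proof (cases "b < 0")
  case True
  \<comment> \<open>This makes \<open>c * b\<close> the midpoint of \<open>a\<close> and
    \<open>b\<close>.\<close>
  define c where "c = (1 + a / b) / 2"
  have "a / b > 1" using True assms by (simp add: field_simps)
  then have "c > 1" by (simp add: c_def)
  moreover have "c * b = (b + a) / 2" using True by (simp add: c_def field_simps)
  ultimately show ?thesis using assms by (intro exI[of _ c]) auto
next
  case False
  then show ?thesis using assms by (intro exI[of _ 2]) auto
qed

lemma eventually_sum_powr_le:
  fixes e1 e2 z B :: real
  assumes "e1 < z" "e2 < z"
  shows "\<forall>\<^sub>F n::nat in sequentially. B * real n powr e1 + real n powr e2 \<le> real n powr z"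
proof -
  have "((\<lambda>n::nat. B * real n powr (e1 - z) + real n powr (e2 - z)) \<longlongrightarrow> B * 0 + 0) sequentially"
    by (intro tendsto_intros tendsto_neg_powr filterlim_real_sequentially) (use assms in auto)
  then have "\<forall>\<^sub>F n::nat in sequentially. B * real n powr (e1 - z) + real n powr (e2 - z) < 1"
    by (rule order_tendstoD) simp
  then show ?thesis
    using eventually_gt_at_top[of 0]
  proof eventually_elim
    case (elim n)
    have "(B * real n powr (e1 - z) + real n powr (e2 - z)) * real n powr z \<le> 1 * real n powr z"
      using elim by (intro mult_right_mono) auto
    moreover have "(B * real n powr (e1 - z) + real n powr (e2 - z)) * real n powr z
        = B * real n powr e1 + real n powr e2"
      by (simp add: distrib_right mult.assoc flip: powr_add)
    ultimately show ?case by simp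
  qed
qed

lemma eventually_powr_le_mult_powr:
  fixes e z B :: real
  assumes "z < e" "0 < B"
  shows "\<forall>\<^sub>F n::nat in sequentially. real n powr z \<le> B * real n powr e"
proof -
  have "\<forall>\<^sub>F n::nat in sequentially. (1 / B) * real n powr z + real n powr z \<le> real n powr e"
    by (rule eventually_sum_powr_le) (use assms in auto)
  then show ?thesis
  proof eventually_elim
    case (elim n)
    then have "(1 / B) * real n powr z \<le> real n powr e"
      using powr_ge_zero[of "real n" z] by linarith
    then show ?case using assms by (simp add: field_simps)
  qed
qed

text \<open>Separates the analysis of rates from probability: \<open>T u\<close> stands for P(X > u)
  and \<open>Q n\<close> for the probability that the sum is large. In \<open>upper\<close> the last
  term is an error below any prescribed power, because \<open>K\<close> is arbitrary; the loss of
  scale \<open>c\<close> is chosen later according to the gap between exponents.\<close>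

locale tail_comparison =
  fixes T :: "real \<Rightarrow> real" and Q :: "nat \<Rightarrow> real" and p :: real
  assumes p_pos: "0 < p"
    and T_nonneg: "\<And>u. 0 \<le> T u"
    and T_antimono: "antimono T"
    and Q_nonneg: "\<And>n. 0 \<le> Q n"
    and upper: "\<And>c K. 1 < c \<Longrightarrow>
      \<forall>\<^sub>F n in sequentially. Q n \<le> real n * T (real n powr (1 / (c * p))) + real n powr (- K)"
    and lower: "\<And>c. 1 < c \<Longrightarrow>
      \<forall>\<^sub>F n in sequentially. real n * T (real n powr (c / p)) / 2 \<le> Q n"
begin

text \<open>The argument \<open>exp t\<close> appears because log X > t means X >
  \<open>exp t\<close>.\<close>

definition tail_rate :: "real \<Rightarrow> ereal" where
  "tail_rate t = ereal (1 / t) * elog (T (exp t))"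

text \<open>The values at \<open>n = 0\<close> and \<open>n = 1\<close> are artefacts of total
  functions; the inequalities below are stated for \<open>1 < n\<close>.\<close>

definition rate :: "nat \<Rightarrow> ereal" where
  "rate n = elog (Q n) / ereal (ln (real n))"

section \<open>Bounds on the two rates as inequalities between powers, and their transfer\<close>

lemma tail_rate_le_iff: "0 < t \<Longrightarrow> tail_rate t \<le> ereal a \<longleftrightarrow> T (exp t) \<le> exp (t * a)"
proof -
  assume t: "0 < t"
  have "tail_rate t = elog (T (exp t)) / ereal t"
    using t by (simp add: tail_rate_def divide_ereal_def inverse_eq_divide mult.commute)
  then show ?thesis using elog_divide_le_iff[OF T_nonneg t] by simp
qed

lemma le_tail_rate_iff: "0 < t \<Longrightarrow> ereal a \<le> tail_rate t \<longleftrightarrow> exp (t * a) \<le> T (exp t)"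
proof -
  assume t: "0 < t"
  have "tail_rate t = elog (T (exp t)) / ereal t"
    using t by (simp add: tail_rate_def divide_ereal_def inverse_eq_divide mult.commute)
  then show ?thesis using le_elog_divide_iff[OF T_nonneg t] by simp
qed

lemma rate_le_iff: "1 < n \<Longrightarrow> rate n \<le> ereal z \<longleftrightarrow> Q n \<le> real n powr z"
  using elog_divide_le_iff[OF Q_nonneg, of "ln (real n)" n z]
  by (simp add: rate_def powr_def mult.commute)

lemma le_rate_iff: "1 < n \<Longrightarrow> ereal z \<le> rate n \<longleftrightarrow> real n powr z \<le> Q n"
  using le_elog_divide_iff[OF Q_nonneg, of "ln (real n)" z n]
  by (simp add: rate_def powr_def mult.commute)

text \<open>With \<open>k = c * p\<close> the truncation level in \<open>upper\<close> is
  \<open>n powr (1 / k)\<close>, which is at least \<open>exp t\<close>, so its tail is at most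
  \<open>exp (t * a)\<close>, about \<open>n powr (a / k)\<close>. The factor \<open>n\<close> adds
  1 to the exponent, and \<open>c\<close> is chosen with \<open>a / k + 1 < z\<close>. Allowing
  \<open>n\<close> and \<open>exp (k * t)\<close> to differ by a factor 2 lets one statement serve
  both for given \<open>n\<close> and for given \<open>t\<close>.\<close>

lemma rate_le_of_tail_rate_le:
  assumes "a < p * (z - 1)"
  obtains k where "0 < k"
    "\<forall>\<^sub>F n::nat in sequentially. \<forall>t>0. exp (k * t) \<le> real n \<longrightarrow> real n \<le> 2 * exp (k * t) \<longrightarrow>
       tail_rate t \<le> ereal a \<longrightarrow> rate n \<le> ereal z"
proof -
  obtain c where c: "1 < c" "a < c * (p * (z - 1))" using ex_scale_gt[OF assms] by auto
  define k where "k = c * p"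
  have k: "0 < k" using c p_pos by (simp add: k_def)
  have "a / k + 1 < z" using c k p_pos by (simp add: k_def field_simps)
  \<comment> \<open>The factor \<open>2 powr (\<bar>a\<bar> / k)\<close> pays for the gap between
    \<open>k * t\<close> and \<open>ln n\<close>, and \<open>K = 1 + \<bar>z\<bar>\<close> puts the
    error below \<open>n powr z\<close>.\<close>
  then have "\<forall>\<^sub>F n::nat in sequentially.
      2 powr (\<bar>a\<bar> / k) * real n powr (a / k + 1) + real n powr (- (1 + \<bar>z\<bar>)) \<le> real n powr z"
    by (intro eventually_sum_powr_le) auto
  then have "\<forall>\<^sub>F n::nat in sequentially. \<forall>t>0. exp (k * t) \<le> real n \<longrightarrow> real n \<le> 2 * exp (k * t) \<longrightarrow>
       tail_rate t \<le> ereal a \<longrightarrow> rate n \<le> ereal z"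
    using upper[OF c(1), of "1 + \<bar>z\<bar>"] eventually_gt_at_top[of 1]
  proof eventually_elim
    case (elim n)
    show ?case
    proof (intro allI impI)
      fix t :: real
      assume t: "0 < t" "exp (k * t) \<le> real n" "real n \<le> 2 * exp (k * t)" "tail_rate t \<le> ereal a"
      have n: "real n > 0" using elim by simp
      have le: "k * t \<le> ln (real n)"
        using t(2) n by (simp add: ln_ge_iff)
      have ge: "ln (real n) \<le> ln 2 + k * t"
        using t(3) n ln_le_cancel_iff[of "real n" "2 * exp (k * t)"] by (simp add: ln_mult)
      have "exp t \<le> real n powr (1 / k)"
        using le k n by (simp add: powr_def field_simps)
      then have "T (real n powr (1 / k)) \<le> T (exp t)"
        using T_antimono by (simp add: antimono_def)
      also have "\<dots> \<le> exp (t * a)" using t tail_rate_le_iff by simp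
      also have "\<dots> \<le> exp (\<bar>a\<bar> / k * ln 2 + a / k * ln (real n))"
      proof -
        have "a * (k * t - ln (real n)) \<le> \<bar>a\<bar> * \<bar>k * t - ln (real n)\<bar>"
          by (simp flip: abs_mult)
        also have "\<dots> \<le> \<bar>a\<bar> * ln 2" using le ge by (intro mult_left_mono) auto
        finally have "a * (k * t - ln (real n)) \<le> \<bar>a\<bar> * ln 2" .
        then have "a * (k * t) / k \<le> (\<bar>a\<bar> * ln 2 + a * ln (real n)) / k"
          using k by (intro divide_right_mono) (auto simp: algebra_simps)
        then show ?thesis using k by (simp add: add_divide_distrib mult.commute)
      qed
      also have "\<dots> = 2 powr (\<bar>a\<bar> / k) * real n powr (a / k)"
        using n by (simp add: powr_def exp_add)
      finally have "real n * T (real n powr (1 / k)) \<le> real n * (2 powr (\<bar>a\<bar> / k) * real n powr (a / k))"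
        using n by (intro mult_left_mono) auto
      also have "\<dots> = 2 powr (\<bar>a\<bar> / k) * real n powr (a / k + 1)"
        using n by (simp add: powr_add)
      finally have "Q n \<le> real n powr z" using elim by (simp add: k_def)
      then show "rate n \<le> ereal z" using rate_le_iff elim by simp
    qed
  qed
  with k that show ?thesis by blast
qed

text \<open>Mirror image, with \<open>k = p / c\<close>: now \<open>n powr (1 / k)\<close> must be
  at most \<open>exp t\<close>, so \<open>n\<close> lies below \<open>exp (k * t)\<close>, again up
  to a factor 2. The factor 1 / 2 in \<open>lower\<close> is absorbed by the strict gap
  \<open>z < b / k + 1\<close>.\<close>

lemma rate_ge_of_tail_rate_ge:
  assumes "p * (z - 1) < b"
  obtains k where "0 < k"
    "\<forall>\<^sub>F n::nat in sequentially. \<forall>t>0. exp (k * t) \<le> 2 * real n \<longrightarrow> real n \<le> exp (k * t) \<longrightarrow>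
       ereal b \<le> tail_rate t \<longrightarrow> ereal z \<le> rate n"
proof -
  obtain c where c: "1 < c" "p * (z - 1) < c * b" using ex_scale_gt[OF assms] by auto
  define k where "k = p / c"
  have k: "0 < k" using c p_pos by (simp add: k_def)
  have "z < b / k + 1" using c k p_pos by (simp add: k_def field_simps)
  then have "\<forall>\<^sub>F n::nat in sequentially.
      real n powr z \<le> (2 powr (- \<bar>b\<bar> / k) / 2) * real n powr (b / k + 1)"
    by (intro eventually_powr_le_mult_powr) auto
  then have "\<forall>\<^sub>F n::nat in sequentially. \<forall>t>0. exp (k * t) \<le> 2 * real n \<longrightarrow> real n \<le> exp (k * t) \<longrightarrow>
       ereal b \<le> tail_rate t \<longrightarrow> ereal z \<le> rate n"
    using lower[OF c(1)] eventually_gt_at_top[of 1]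
  proof eventually_elim
    case (elim n)
    show ?case
    proof (intro allI impI)
      fix t :: real
      assume t: "0 < t" "exp (k * t) \<le> 2 * real n" "real n \<le> exp (k * t)" "ereal b \<le> tail_rate t"
      have n: "real n > 0" using elim by simp
      have ge: "ln (real n) \<le> k * t"
        using t(3) n ln_le_cancel_iff[of "real n" "exp (k * t)"] by simp
      have le: "k * t \<le> ln 2 + ln (real n)"
      proof -
        have "k * t \<le> ln (2 * real n)" using t(2) n by (simp add: ln_ge_iff)
        then show ?thesis using n by (simp add: ln_mult)
      qed
      have "real n powr (1 / k) \<le> exp t"
        using ge k n by (simp add: powr_def field_simps)
      then have "T (exp t) \<le> T (real n powr (1 / k))"
        using T_antimono by (simp add: antimono_def)
      moreover have "exp (t * b) \<le> T (exp t)" using t le_tail_rate_iff by simp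
      ultimately have T_ge: "exp (t * b) \<le> T (real n powr (1 / k))" by simp
      have "exp (- \<bar>b\<bar> / k * ln 2 + b / k * ln (real n)) \<le> exp (t * b)"
      proof -
        have "- b * (k * t - ln (real n)) \<le> \<bar>- b * (k * t - ln (real n))\<bar>"
          by (rule abs_ge_self)
        also have "\<dots> = \<bar>b\<bar> * \<bar>k * t - ln (real n)\<bar>" by (simp add: abs_mult)
        also have "\<dots> \<le> \<bar>b\<bar> * ln 2" using le ge by (intro mult_left_mono) auto
        finally have "- b * (k * t - ln (real n)) \<le> \<bar>b\<bar> * ln 2" .
        then have "(- \<bar>b\<bar> * ln 2 + b * ln (real n)) / k \<le> b * (k * t) / k"
          using k by (intro divide_right_mono) (auto simp: algebra_simps)
        then show ?thesis using k by (simp add: add_divide_distrib diff_divide_distrib mult.commute)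
      qed
      also note T_ge
      also have "exp (- \<bar>b\<bar> / k * ln 2 + b / k * ln (real n)) = 2 powr (- \<bar>b\<bar> / k) * real n powr (b / k)"
        using n by (simp add: powr_def exp_add exp_diff exp_minus field_simps)
      finally have "real n * (2 powr (- \<bar>b\<bar> / k) * real n powr (b / k)) \<le> real n * T (real n powr (1 / k))"
        using n by (intro mult_left_mono) simp_all
      moreover have "real n * (2 powr (- \<bar>b\<bar> / k) * real n powr (b / k)) = 2 powr (- \<bar>b\<bar> / k) * real n powr (b / k + 1)"
        using n by (simp add: powr_add)
      moreover have "real n * T (real n powr (1 / k)) / 2 \<le> Q n" using elim(2) by (simp add: k_def)
      ultimately have "real n powr z \<le> Q n" using elim by linarith
      then show "ereal z \<le> rate n" using le_rate_iff elim by simp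
    qed
  qed
  with k that show ?thesis by blast
qed

section \<open>Passing between integers and real arguments; limits of the rates\<close>

lemma filterlim_ln_over: "0 < k \<Longrightarrow> filterlim (\<lambda>n. ln (real n) / k) at_top sequentially"
  by real_asymp

lemma filterlim_nat_floor_exp:
  assumes "0 < k"
  shows "filterlim (\<lambda>t. nat \<lfloor>exp (k * t :: real)\<rfloor>) sequentially at_top"
proof -
  have "filterlim (\<lambda>t. exp (k * t)) at_top at_top" using assms by real_asymp
  then show ?thesis
    by (intro filterlim_compose[OF filterlim_nat_sequentially] filterlim_compose[OF filterlim_floor_sequentially])
qed

lemma filterlim_nat_ceiling_exp:
  assumes "0 < k"
  shows "filterlim (\<lambda>t. nat \<lceil>exp (k * t :: real)\<rceil>) sequentially at_top"
  by (rule filterlim_at_top_mono[OF filterlim_nat_floor_exp[OF assms]])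
     (auto intro!: always_eventually nat_mono floor_le_ceiling)

text \<open>The increasing map taking \<open>x\<close> to \<open>1 + x / p\<close>, infinite values
  included, written so that \<open>x = - \<alpha>\<close> gives the shape of the theorem.\<close>

definition scale :: "ereal \<Rightarrow> ereal" where
  "scale x = - ((- x - ereal p) / ereal p)"

lemma scale_simps:
  "scale (ereal r) = ereal (1 + r / p)" "scale \<infinity> = \<infinity>" "scale (- \<infinity>) = - \<infinity>"
  using p_pos by (simp_all add: scale_def field_simps)

lemma scale_less_iff: "scale x < ereal z \<longleftrightarrow> x < ereal (p * (z - 1))"
proof (cases x)
  case (real r)
  have "1 + r / p < z \<longleftrightarrow> r / p < z - 1" by linarith
  then show ?thesis using p_pos real by (simp add: scale_simps pos_divide_less_eq mult.commute)
qed (use scale_simps in auto)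

lemma less_scale_iff: "ereal z < scale x \<longleftrightarrow> ereal (p * (z - 1)) < x"
proof (cases x)
  case (real r)
  have "z < 1 + r / p \<longleftrightarrow> z - 1 < r / p" by linarith
  then show ?thesis using p_pos real by (simp add: scale_simps pos_less_divide_eq mult.commute)
qed (use scale_simps in auto)

lemma le_scaleI:
  assumes "\<And>z. scale x < ereal z \<Longrightarrow> y \<le> ereal z"
  shows "y \<le> scale x"
proof (rule ccontr)
  assume "\<not> y \<le> scale x"
  then obtain z where "scale x < ereal z" "ereal z < y"
    using ereal_dense2[of "scale x" y] by (auto simp: not_le)
  with assms show False by force
qed

lemma scale_leI:
  assumes "\<And>z. ereal z < scale x \<Longrightarrow> ereal z \<le> y"
  shows "scale x \<le> y"
proof (rule ccontr)
  assume "\<not> scale x \<le> y"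
  then obtain z where "y < ereal z" "ereal z < scale x"
    using ereal_dense2[of y "scale x"] by (auto simp: not_le)
  with assms show False by force
qed

text \<open>Every large \<open>n\<close> is sampled at \<open>t = ln n / k\<close>, where
  \<open>exp (k * t) = n\<close>, so a bound on the tail rate for all large \<open>t\<close> passes
  to all large \<open>n\<close>.\<close>

lemma limsup_rate_le: "limsup rate \<le> scale (Limsup at_top tail_rate)"
proof (rule le_scaleI)
  fix z assume "scale (Limsup at_top tail_rate) < ereal z"
  then obtain a where a: "Limsup at_top tail_rate < ereal a" "a < p * (z - 1)"
    unfolding scale_less_iff using ereal_dense2 by force
  obtain k where k: "0 < k" and ev: "\<forall>\<^sub>F n::nat in sequentially. \<forall>t>0. exp (k * t) \<le> real n \<longrightarrow>
      real n \<le> 2 * exp (k * t) \<longrightarrow> tail_rate t \<le> ereal a \<longrightarrow> rate n \<le> ereal z"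
    using rate_le_of_tail_rate_le[OF a(2)] .
  have "\<forall>\<^sub>F n in sequentially. tail_rate (ln (real n) / k) < ereal a"
    using Limsup_lessD[OF a(1)] filterlim_ln_over[OF k] by (rule eventually_compose_filterlim)
  then have "\<forall>\<^sub>F n in sequentially. rate n \<le> ereal z"
    using ev eventually_gt_at_top[of 1]
  proof eventually_elim
    case (elim n)
    then show ?case
      using k elim(2)[rule_format, of "ln (real n) / k"] by (simp add: less_imp_le)
  qed
  then show "limsup rate \<le> ereal z" by (rule Limsup_bounded)
qed

lemma liminf_rate_ge: "scale (Liminf at_top tail_rate) \<le> liminf rate"
proof (rule scale_leI)
  fix z assume "ereal z < scale (Liminf at_top tail_rate)"
  then obtain b where b: "ereal b < Liminf at_top tail_rate" "p * (z - 1) < b"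
    unfolding less_scale_iff using ereal_dense2 by force
  obtain k where k: "0 < k" and ev: "\<forall>\<^sub>F n::nat in sequentially. \<forall>t>0. exp (k * t) \<le> 2 * real n \<longrightarrow>
      real n \<le> exp (k * t) \<longrightarrow> ereal b \<le> tail_rate t \<longrightarrow> ereal z \<le> rate n"
    using rate_ge_of_tail_rate_ge[OF b(2)] .
  have "\<forall>\<^sub>F n in sequentially. ereal b < tail_rate (ln (real n) / k)"
    using less_LiminfD[OF b(1)] filterlim_ln_over[OF k] by (rule eventually_compose_filterlim)
  then have "\<forall>\<^sub>F n in sequentially. ereal z \<le> rate n"
    using ev eventually_gt_at_top[of 1]
  proof eventually_elim
    case (elim n)
    then show ?case
      using k elim(2)[rule_format, of "ln (real n) / k"] by (simp add: less_imp_le)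
  qed
  then show "ereal z \<le> liminf rate" by (rule Liminf_bounded)
qed

text \<open>By contraposition: if \<open>rate\<close> stays above \<open>z\<close> for all large
  \<open>n\<close>, then the tail rate is at least \<open>a\<close> for all large \<open>t\<close>.
  Every real \<open>t\<close> must therefore be served by an integer; the ceiling of
  \<open>exp (k * t)\<close> is used since the transfer needs
  \<open>exp (k * t) \<le> n\<close>.\<close>

lemma liminf_rate_le: "liminf rate \<le> scale (Liminf at_top tail_rate)"
proof (rule le_scaleI)
  fix z assume "scale (Liminf at_top tail_rate) < ereal z"
  then obtain a where a: "Liminf at_top tail_rate < ereal a" "a < p * (z - 1)"
    unfolding scale_less_iff using ereal_dense2 by force
  obtain k where k: "0 < k" and ev: "\<forall>\<^sub>F n::nat in sequentially. \<forall>t>0. exp (k * t) \<le> real n \<longrightarrow>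
      real n \<le> 2 * exp (k * t) \<longrightarrow> tail_rate t \<le> ereal a \<longrightarrow> rate n \<le> ereal z"
    using rate_le_of_tail_rate_le[OF a(2)] .
  show "liminf rate \<le> ereal z"
  proof (rule ccontr)
    assume "\<not> liminf rate \<le> ereal z"
    then have "\<forall>\<^sub>F n in sequentially. ereal z < rate n" by (intro less_LiminfD) simp
    from eventually_compose_filterlim[OF eventually_conj[OF this ev] filterlim_nat_ceiling_exp[OF k]]
    have "\<forall>\<^sub>F t in at_top. ereal a \<le> tail_rate t"
      using eventually_gt_at_top[of 0]
    proof eventually_elim
      case (elim t)
      define n where "n = nat \<lceil>exp (k * t)\<rceil>"
      \<comment> \<open>This makes rounding up cost at most a factor 2.\<close>
      have one: "1 \<le> exp (k * t)" using elim k by simp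
      have "real n = of_int \<lceil>exp (k * t)\<rceil>" unfolding n_def by (intro of_nat_nat) (use one in linarith)
      then have "exp (k * t) \<le> real n" "real n \<le> 2 * exp (k * t)"
        using one by linarith+
      with elim have "tail_rate t \<le> ereal a \<Longrightarrow> False" unfolding n_def by (meson not_le)
      then show ?case by (meson linear)
    qed
    then have "ereal a \<le> Liminf at_top tail_rate" by (rule Liminf_bounded)
    with a(1) show False by simp
  qed
qed

text \<open>Contraposition again; here the floor is the right rounding, since the lower transfer
  needs \<open>n \<le> exp (k * t)\<close>.\<close>

lemma limsup_rate_ge: "scale (Limsup at_top tail_rate) \<le> limsup rate"
proof (rule scale_leI)
  fix z assume "ereal z < scale (Limsup at_top tail_rate)"
  then obtain b where b: "ereal b < Limsup at_top tail_rate" "p * (z - 1) < b"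
    unfolding less_scale_iff using ereal_dense2 by force
  obtain k where k: "0 < k" and ev: "\<forall>\<^sub>F n::nat in sequentially. \<forall>t>0. exp (k * t) \<le> 2 * real n \<longrightarrow>
      real n \<le> exp (k * t) \<longrightarrow> ereal b \<le> tail_rate t \<longrightarrow> ereal z \<le> rate n"
    using rate_ge_of_tail_rate_ge[OF b(2)] .
  show "ereal z \<le> limsup rate"
  proof (rule ccontr)
    assume "\<not> ereal z \<le> limsup rate"
    then have "\<forall>\<^sub>F n in sequentially. rate n < ereal z" by (intro Limsup_lessD) simp
    from eventually_compose_filterlim[OF eventually_conj[OF this ev] filterlim_nat_floor_exp[OF k]]
    have "\<forall>\<^sub>F t in at_top. tail_rate t \<le> ereal b"
      using eventually_gt_at_top[of 0]
    proof eventually_elim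
      case (elim t)
      define n where "n = nat \<lfloor>exp (k * t)\<rfloor>"
      have one: "1 \<le> exp (k * t)" using elim k by simp
      have "real n = of_int \<lfloor>exp (k * t)\<rfloor>" unfolding n_def by (intro of_nat_nat) simp
      \<comment> \<open>Since the floor is at least 1, \<open>exp (k * t)\<close> is at most twice
        its floor.\<close>
      moreover have "(1::int) \<le> \<lfloor>exp (k * t)\<rfloor>" using one by (simp add: le_floor_iff)
      ultimately have "real n \<le> exp (k * t)" "exp (k * t) \<le> 2 * real n"
        by linarith+
      with elim have "ereal b \<le> tail_rate t \<Longrightarrow> False" unfolding n_def by (meson not_le)
      then show ?case by (meson linear)
    qed
    then have "Limsup at_top tail_rate \<le> ereal b" by (rule Limsup_bounded)
    with b(1) show False by simp
  qed
qed

lemma limsup_rate: "limsup rate = scale (Limsup at_top tail_rate)"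
  using limsup_rate_le limsup_rate_ge by (rule antisym)

lemma liminf_rate: "liminf rate = scale (Liminf at_top tail_rate)"
  using liminf_rate_le liminf_rate_ge by (rule antisym)

lemma scale_eq_iff: "scale (- x) = scale (- y) \<longleftrightarrow> x = y"
  using p_pos by (cases x; cases y) (auto simp: scale_simps)

text \<open>Convergence means that lower and upper limit equal the candidate, and injectivity of
  \<open>scale\<close> strips the affine map from both equations.\<close>

lemma rate_tendsto_iff:
  "rate \<longlonglongrightarrow> scale (- \<alpha>) \<longleftrightarrow> - Limsup at_top tail_rate = \<alpha> \<and> - Liminf at_top tail_rate = \<alpha>"
  using scale_eq_iff[of "- Limsup at_top tail_rate" \<alpha>] scale_eq_iff[of "- Liminf at_top tail_rate" \<alpha>]
  by (auto simp: tendsto_iff_Liminf_eq_Limsup limsup_rate liminf_rate)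

end

section \<open>Truncated sums\<close>

lemma exp_le_quadratic:
  fixes x :: real
  assumes "x \<le> 1"
  shows "exp x \<le> 1 + x + x\<^sup>2"
proof (cases "0 \<le> x")
  case True
  then show ?thesis using assms by (rule exp_bound)
next
  case False
  \<comment> \<open>For negative \<open>x\<close> both sides are multiplied by
    \<open>1 - x > 0\<close>: the left one is then at most 1, and the right one becomes
    \<open>1 - x ^ 3\<close>, which is at least 1.\<close>
  have "exp x * (1 - x) \<le> exp x * exp (- x)"
    using exp_ge_add_one_self[of "- x"] by (intro mult_left_mono) auto
  also have "\<dots> \<le> 1 - x ^ 3" using False by (simp flip: exp_add)
  also have "\<dots> = (1 + x + x\<^sup>2) * (1 - x)" by (simp add: power2_eq_square power3_eq_cube algebra_simps)
  finally show ?thesis using False by simp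
qed

text \<open>The power 2 is split into \<open>2 - q\<close> and \<open>q\<close>; the minimum is
  bounded by \<open>y\<close> in the first factor and by \<open>x\<close> in the second.\<close>

lemma min_square_le_powr:
  fixes x y q :: real
  assumes "0 \<le> x" "0 < y" "0 < q" "q \<le> 2"
  shows "(min x y)\<^sup>2 \<le> y powr (2 - q) * x powr q"
proof (cases "x = 0")
  case False
  then have z: "0 < min x y" using assms by simp
  have "(min x y)\<^sup>2 = min x y powr (2 - q) * min x y powr q"
    using z by (simp flip: powr_add)
  also have "\<dots> \<le> y powr (2 - q) * x powr q"
    using assms by (intro mult_mono powr_mono2) auto
  finally show ?thesis .
qed (use assms in auto)

lemma min_le_powr:
  fixes x y q :: real
  assumes "0 \<le> x" "0 < y" "0 < q" "q \<le> 1"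
  shows "min x y \<le> y powr (1 - q) * x powr q"
proof (cases "x = 0")
  case False
  then have z: "0 < min x y" using assms by simp
  have "min x y = min x y powr (1 - q) * min x y powr q"
    using z by (simp flip: powr_add)
  also have "\<dots> \<le> y powr (1 - q) * x powr q"
    using assms by (intro mult_mono powr_mono2) auto
  finally show ?thesis .
qed (use assms in auto)

text \<open>Where \<open>x > y\<close> the nonpositive exponent \<open>1 - q\<close> gives
  \<open>x powr (1 - q) \<le> y powr (1 - q)\<close>; elsewhere the difference vanishes.\<close>

lemma diff_min_le_powr:
  fixes x y q :: real
  assumes "0 \<le> x" "0 < y" "1 \<le> q"
  shows "x - min x y \<le> y powr (1 - q) * x powr q"
proof (cases "x \<le> y")
  case False
  have "x - min x y \<le> x" using assms by simp
  also have "x = x powr (1 - q) * x powr q"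
    using False assms by (simp flip: powr_add)
  also have "\<dots> \<le> y powr (1 - q) * x powr q"
    using False assms by (intro mult_right_mono powr_mono2') auto
  finally show ?thesis .
qed (use assms in auto)

section \<open>Tails and truncated moments of the i.i.d. family\<close>

locale iid_nonneg = prob_space M for M :: "'a measure" +
  fixes X :: "nat \<Rightarrow> 'a \<Rightarrow> real"
  assumes rv [measurable]: "\<And>i. X i \<in> borel_measurable M"
    and indep: "indep_vars (\<lambda>_. borel) X UNIV"
    and ident: "\<And>i. distr M borel (X i) = distr M borel (X 0)"
    and nonneg: "\<And>i \<omega>. \<omega> \<in> space M \<Longrightarrow> 0 \<le> X i \<omega>"
begin

definition tail :: "real \<Rightarrow> real" where
  "tail u = prob {\<omega> \<in> space M. u < X 0 \<omega>}"

text \<open>Truncation is capping at \<open>y\<close>, so that a sum without summands above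
  \<open>y\<close> is unchanged.\<close>

definition trunc_mean :: "real \<Rightarrow> real" where
  "trunc_mean y = expectation (\<lambda>\<omega>. min (X 0 \<omega>) y)"

definition trunc_square :: "real \<Rightarrow> real" where
  "trunc_square y = expectation (\<lambda>\<omega>. (min (X 0 \<omega>) y)\<^sup>2)"

lemma measurable_psum [measurable]: "psum X n \<in> borel_measurable M"
  unfolding psum_def by measurable

lemma tail_nonneg: "0 \<le> tail u"
  by (simp add: tail_def)

lemma antimono_tail: "antimono tail"
  unfolding tail_def by (intro antimonoI finite_measure_mono) auto

lemma prob_X_eq:
  assumes "A \<in> sets borel"
  shows "prob {\<omega> \<in> space M. X i \<omega> \<in> A} = prob {\<omega> \<in> space M. X 0 \<omega> \<in> A}"
proof -
  have "prob {\<omega> \<in> space M. X i \<omega> \<in> A} = measure (distr M borel (X i)) A" for i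
    using assms by (simp add: measure_distr vimage_def Int_def conj_commute)
  then show ?thesis using ident[of i] by simp
qed

lemma tail_eq: "prob {\<omega> \<in> space M. u < X i \<omega>} = tail u"
  using prob_X_eq[of "{u<..}" i] by (simp add: tail_def)

lemma expectation_X_eq:
  fixes f :: "real \<Rightarrow> real"
  assumes [measurable]: "f \<in> borel_measurable borel"
  shows "expectation (\<lambda>\<omega>. f (X i \<omega>)) = expectation (\<lambda>\<omega>. f (X 0 \<omega>))"
proof -
  have "expectation (\<lambda>\<omega>. f (X i \<omega>)) = integral\<^sup>L (distr M borel (X i)) f" for i
    by (simp add: integral_distr)
  then show ?thesis using ident[of i] by simp
qed

section \<open>Exponential moments and deviations of truncated sums\<close>

lemma integrable_trunc: "0 \<le> y \<Longrightarrow> integrable M (\<lambda>\<omega>. min (X i \<omega>) y)"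
  by (rule integrable_const_bound[of _ y]) (auto intro!: AE_I2 dest: nonneg[of _ i])

lemma integrable_trunc_square: "0 \<le> y \<Longrightarrow> integrable M (\<lambda>\<omega>. (min (X i \<omega>) y)\<^sup>2)"
  by (rule integrable_const_bound[of _ "y\<^sup>2"])
     (auto intro!: AE_I2 power_mono dest: nonneg[of _ i])

text \<open>The quadratic bound on \<open>exp\<close> is integrated, and
  \<open>1 + u \<le> exp u\<close> closes the estimate. The condition on \<open>\<theta>\<close>
  covers small positive values as well as all negative ones, so that upper and lower deviations both
  follow.\<close>

lemma expectation_exp_trunc_le:
  assumes "0 \<le> y" and \<theta>: "\<And>x. 0 \<le> x \<Longrightarrow> \<theta> * min x y \<le> 1"
  shows "integrable M (\<lambda>\<omega>. exp (\<theta> * min (X i \<omega>) y))"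
    and "expectation (\<lambda>\<omega>. exp (\<theta> * min (X i \<omega>) y)) \<le> exp (\<theta> * trunc_mean y + \<theta>\<^sup>2 * trunc_square y)"
proof -
  show int: "integrable M (\<lambda>\<omega>. exp (\<theta> * min (X i \<omega>) y))"
    using \<theta> nonneg by (intro integrable_const_bound[of _ "exp 1"]) (auto intro!: AE_I2)
  note [simp] = integrable_trunc[OF \<open>0 \<le> y\<close>] integrable_trunc_square[OF \<open>0 \<le> y\<close>] prob_space
  have "expectation (\<lambda>\<omega>. exp (\<theta> * min (X i \<omega>) y))
      \<le> expectation (\<lambda>\<omega>. 1 + \<theta> * min (X i \<omega>) y + \<theta>\<^sup>2 * (min (X i \<omega>) y)\<^sup>2)"
    using \<theta> nonneg by (intro integral_mono int)
      (auto intro!: order_trans[OF exp_le_quadratic] simp: power_mult_distrib)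
  also have "\<dots> = 1 + \<theta> * expectation (\<lambda>\<omega>. min (X i \<omega>) y) + \<theta>\<^sup>2 * expectation (\<lambda>\<omega>. (min (X i \<omega>) y)\<^sup>2)"
    by simp
  also have "\<dots> = 1 + (\<theta> * trunc_mean y + \<theta>\<^sup>2 * trunc_square y)"
    using expectation_X_eq[of "\<lambda>x. min x y" i] expectation_X_eq[of "\<lambda>x. (min x y)\<^sup>2" i]
    by (simp add: trunc_mean_def trunc_square_def)
  also have "\<dots> \<le> exp (\<theta> * trunc_mean y + \<theta>\<^sup>2 * trunc_square y)" by (rule exp_ge_add_one_self)
  finally show "expectation (\<lambda>\<omega>. exp (\<theta> * min (X i \<omega>) y)) \<le> \<dots>" .
qed

lemma expectation_exp_sum_trunc_le:
  assumes "finite I" "0 \<le> y" and \<theta>: "\<And>x. 0 \<le> x \<Longrightarrow> \<theta> * min x y \<le> 1"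
  shows "integrable M (\<lambda>\<omega>. exp (\<theta> * (\<Sum>i\<in>I. min (X i \<omega>) y)))" (is ?int)
    and "expectation (\<lambda>\<omega>. exp (\<theta> * (\<Sum>i\<in>I. min (X i \<omega>) y)))
      \<le> exp (real (card I) * (\<theta> * trunc_mean y + \<theta>\<^sup>2 * trunc_square y))" (is ?le)
proof -
  have eq: "exp (\<theta> * (\<Sum>i\<in>I. min (X i \<omega>) y)) = (\<Prod>i\<in>I. exp (\<theta> * min (X i \<omega>) y))" for \<omega>
    using assms by (simp add: sum_distrib_left exp_sum)
  have ind: "indep_vars (\<lambda>_. borel) (\<lambda>i \<omega>. exp (\<theta> * min (X i \<omega>) y)) I"
    by (rule indep_vars_compose2[OF indep_vars_subset[OF indep]]) auto
  note e = expectation_exp_trunc_le[OF \<open>0 \<le> y\<close> \<theta>]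
  show ?int unfolding eq using assms(1) ind e(1) by (rule indep_vars_integrable)
  have "expectation (\<lambda>\<omega>. \<Prod>i\<in>I. exp (\<theta> * min (X i \<omega>) y)) = (\<Prod>i\<in>I. expectation (\<lambda>\<omega>. exp (\<theta> * min (X i \<omega>) y)))"
    using assms(1) ind e(1) by (rule indep_vars_lebesgue_integral)
  also have "\<dots> \<le> (\<Prod>i\<in>I. exp (\<theta> * trunc_mean y + \<theta>\<^sup>2 * trunc_square y))"
    using e(2) by (intro prod_mono) auto
  also have "\<dots> = exp (real (card I) * (\<theta> * trunc_mean y + \<theta>\<^sup>2 * trunc_square y))"
    by (simp add: exp_of_nat_mult)
  finally show ?le unfolding eq .
qed

lemma prob_sum_trunc_ge:
  assumes "finite I" "0 \<le> y" "0 < \<theta>" "\<theta> * y \<le> 1"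
  shows "prob {\<omega> \<in> space M. a \<le> (\<Sum>i\<in>I. min (X i \<omega>) y)}
    \<le> exp (- \<theta> * a + real (card I) * (\<theta> * trunc_mean y + \<theta>\<^sup>2 * trunc_square y))"
proof -
  have "\<theta> * min x y \<le> 1" for x
    using assms(3,4) mult_left_mono[of "min x y" y \<theta>] by linarith
  note e = expectation_exp_sum_trunc_le[OF assms(1,2) this]
  have "prob {\<omega> \<in> space M. a \<le> (\<Sum>i\<in>I. min (X i \<omega>) y)}
      \<le> exp (- \<theta> * a) * expectation (\<lambda>\<omega>. exp (\<theta> * (\<Sum>i\<in>I. min (X i \<omega>) y)))"
    using Chernoff_ineq_ge[OF \<open>0 < \<theta>\<close>, of "space M" "\<lambda>\<omega>. \<Sum>i\<in>I. min (X i \<omega>) y" a] e(1)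
      integrable_mult_indicator[OF sets.top e(1)]
    by (simp add: set_integral_space set_integrable_def)
  also have "\<dots> \<le> exp (- \<theta> * a) * exp (real (card I) * (\<theta> * trunc_mean y + \<theta>\<^sup>2 * trunc_square y))"
    by (intro mult_left_mono e(2)) auto
  finally show ?thesis unfolding exp_add .
qed

text \<open>Exponential Markov inequality with parameter \<open>- \<theta>\<close>. Capped summands
  are non-negative, so \<open>\<theta>\<close> may be large compared with
  \<open>1 / y\<close>.\<close>

lemma prob_sum_trunc_le:
  assumes "finite I" "0 \<le> y" "0 < \<theta>"
  shows "prob {\<omega> \<in> space M. (\<Sum>i\<in>I. min (X i \<omega>) y) \<le> a}
    \<le> exp (\<theta> * a - real (card I) * (\<theta> * trunc_mean y - \<theta>\<^sup>2 * trunc_square y))"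
proof -
  have "- \<theta> * min x y \<le> 1" if "0 \<le> x" for x
    using assms that mult_nonneg_nonneg[of \<theta> "min x y"] by linarith
  note e = expectation_exp_sum_trunc_le[OF assms(1,2) this]
  have "prob {\<omega> \<in> space M. (\<Sum>i\<in>I. min (X i \<omega>) y) \<le> a}
      \<le> exp (\<theta> * a) * expectation (\<lambda>\<omega>. exp (- \<theta> * (\<Sum>i\<in>I. min (X i \<omega>) y)))"
    using Chernoff_ineq_le[OF \<open>0 < \<theta>\<close>, of "space M" "\<lambda>\<omega>. \<Sum>i\<in>I. min (X i \<omega>) y" a] e(1)
      integrable_mult_indicator[OF sets.top e(1)]
    by (simp add: set_integral_space set_integrable_def)
  also have "\<dots> \<le> exp (\<theta> * a) * exp (real (card I) * (- \<theta> * trunc_mean y + (- \<theta>)\<^sup>2 * trunc_square y))"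
    by (intro mult_left_mono e(2)) auto
  finally show ?thesis by (simp add: algebra_simps flip: exp_add)
qed

text \<open>Either some summand exceeds \<open>y\<close>, which costs \<open>n * tail y\<close> by
  the union bound, or the sum equals its capped version and the exponential bound applies.\<close>

lemma prob_psum_gt_le:
  assumes "0 \<le> y" "0 < \<theta>" "\<theta> * y \<le> 1"
  shows "prob {\<omega> \<in> space M. a < psum X n \<omega>}
    \<le> real n * tail y + exp (- \<theta> * a + real n * (\<theta> * trunc_mean y + \<theta>\<^sup>2 * trunc_square y))"
proof -
  let ?A = "\<Union>i\<in>{1..n}. {\<omega> \<in> space M. y < X i \<omega>}"
  let ?B = "{\<omega> \<in> space M. a \<le> (\<Sum>i\<in>{1..n}. min (X i \<omega>) y)}"
  have "{\<omega> \<in> space M. a < psum X n \<omega>} \<subseteq> ?A \<union> ?B"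
  proof
    fix \<omega> assume \<omega>: "\<omega> \<in> {\<omega> \<in> space M. a < psum X n \<omega>}"
    show "\<omega> \<in> ?A \<union> ?B"
    proof (cases "\<omega> \<in> ?A")
      case False
      then have "(\<Sum>i\<in>{1..n}. min (X i \<omega>) y) = psum X n \<omega>"
        unfolding psum_def using \<omega> by (intro sum.cong) (auto simp: not_less)
      then show ?thesis using \<omega> by auto
    qed auto
  qed
  then have "prob {\<omega> \<in> space M. a < psum X n \<omega>} \<le> prob (?A \<union> ?B)"
    by (intro finite_measure_mono) auto
  also have "\<dots> \<le> prob ?A + prob ?B" by (intro measure_Un_le) auto
  also have "prob ?A \<le> (\<Sum>i\<in>{1..n}. prob {\<omega> \<in> space M. y < X i \<omega>})"
    by (intro measure_UNION_le) auto
  also have "\<dots> = real n * tail y" by (simp add: tail_eq)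
  also have "prob ?B \<le> exp (- \<theta> * a + real n * (\<theta> * trunc_mean y + \<theta>\<^sup>2 * trunc_square y))"
    using prob_sum_trunc_ge[of "{1..n}", OF _ assms] by simp
  finally show ?thesis by simp
qed

section \<open>One large summand forces a large sum\<close>

lemma prob_X_gt_and_sum:
  fixes h :: "real \<Rightarrow> real"
  assumes "finite I" "i \<notin> I" and [measurable]: "h \<in> borel_measurable borel"
  shows "prob {\<omega> \<in> space M. u < X i \<omega> \<and> b \<le> (\<Sum>j\<in>I. h (X j \<omega>))}
    = tail u * prob {\<omega> \<in> space M. b \<le> (\<Sum>j\<in>I. h (X j \<omega>))}"
proof -
  \<comment> \<open>\<open>g\<close> keeps summand \<open>i\<close> as it is and applies
    \<open>h\<close> to the others, so that a single independent family yields \<open>X i\<close>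
    together with the transformed sum.\<close>
  define g where "g j = (if j = i then (\<lambda>x. x) else h)" for j
  have [measurable]: "g j \<in> borel_measurable borel" for j by (simp add: g_def)
  have "indep_vars (\<lambda>_. borel) (\<lambda>j \<omega>. g j (X j \<omega>)) (insert i I)"
    by (rule indep_vars_compose2[OF indep_vars_subset[OF indep]]) auto
  from indep_vars_sum[OF assms(1,2) this]
  have "indep_var borel (\<lambda>\<omega>. g i (X i \<omega>)) borel (\<lambda>\<omega>. \<Sum>j\<in>I. g j (X j \<omega>))" .
  moreover have "(\<lambda>\<omega>. \<Sum>j\<in>I. g j (X j \<omega>)) = (\<lambda>\<omega>. \<Sum>j\<in>I. h (X j \<omega>))"
    using assms(2) by (intro ext sum.cong) (auto simp: g_def)
  ultimately have "indep_var borel (X i) borel (\<lambda>\<omega>. \<Sum>j\<in>I. h (X j \<omega>))"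
    by (simp add: g_def)
  from indep_varD[OF this, of "{u<..}" "{b..}"]
  show ?thesis by (simp add: vimage_def Int_def conj_commute conj_left_commute flip: tail_eq[of _ i])
qed

text \<open>
  The events that exactly one summand exceeds \<open>y\<close> are disjoint, and independence of that summand
  from the other ones makes each of them at least half as likely as the excess itself.
\<close>

lemma prob_psum_gt_ge:
  assumes "0 \<le> y" "0 < n" "real n * tail y \<le> 1 / 4"
    and left: "\<And>i. i \<in> {1..n} \<Longrightarrow> prob {\<omega> \<in> space M. (\<Sum>j\<in>{1..n} - {i}. X j \<omega>) < b} \<le> 1 / 4"
  shows "real n * tail y / 2 \<le> prob {\<omega> \<in> space M. y + b < psum X n \<omega>}"
proof -
  \<comment> \<open>The penalty pushes the sum below \<open>b\<close> as soon as one summand exceeds \<open>y\<close>, so that a single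
    sum encodes both conditions on the other summands.\<close>
  define h where "h x = (if x \<le> y then x else - (real n * y + \<bar>b\<bar> + 1))" for x
  have h[measurable]: "h \<in> borel_measurable borel" unfolding h_def by measurable
  define D where "D i = {\<omega> \<in> space M. y < X i \<omega> \<and> b \<le> (\<Sum>j\<in>{1..n} - {i}. h (X j \<omega>))}" for i
  have D_sets[measurable]: "D i \<in> sets M" for i unfolding D_def by measurable
  \<comment> \<open>One penalised summand outweighs the others, which add at most
    \<open>n * y\<close>: the sum would be at most \<open>- \<bar>b\<bar> - 1\<close>, hence below
    \<open>b\<close>.\<close>
  have small: "X j \<omega> \<le> y" if "\<omega> \<in> D i" "j \<in> {1..n} - {i}" for i j \<omega>
  proof (rule ccontr)
    assume "\<not> X j \<omega> \<le> y"
    have "(\<Sum>k\<in>{1..n} - {i}. h (X k \<omega>)) = h (X j \<omega>) + (\<Sum>k\<in>{1..n} - {i} - {j}. h (X k \<omega>))"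
      using that by (intro sum.remove) auto
    also have "(\<Sum>k\<in>{1..n} - {i} - {j}. h (X k \<omega>)) \<le> (\<Sum>k\<in>{1..n} - {i} - {j}. y)"
    proof (intro sum_mono)
      have "0 \<le> real n * y" using \<open>0 \<le> y\<close> by simp
      then have "- (real n * y + \<bar>b\<bar> + 1) \<le> y" using \<open>0 \<le> y\<close> by linarith
      then show "h (X k \<omega>) \<le> y" for k by (simp add: h_def)
    qed
    also have "\<dots> \<le> real n * y"
    proof -
      have "card ({1..n} - {i} - {j}) \<le> card {1..n}" by (intro card_mono) auto
      then show ?thesis using \<open>0 \<le> y\<close> by (auto intro!: mult_right_mono)
    qed
    also have "h (X j \<omega>) = - (real n * y + \<bar>b\<bar> + 1)" using \<open>\<not> X j \<omega> \<le> y\<close> by (simp add: h_def)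
    finally have "(\<Sum>k\<in>{1..n} - {i}. h (X k \<omega>)) < b" by simp
    then show False using that by (simp add: D_def)
  qed
  have disj: "disjoint_family_on D {1..n}"
    unfolding disjoint_family_on_def
  proof (intro ballI impI, rule ccontr)
    fix i j assume ij: "i \<in> {1..n}" "j \<in> {1..n}" "i \<noteq> j" and "D i \<inter> D j \<noteq> {}"
    then obtain \<omega> where \<omega>: "\<omega> \<in> D i" "\<omega> \<in> D j" by auto
    have "X j \<omega> \<le> y" using small[OF \<omega>(1)] ij by simp
    then show False using \<omega>(2) by (simp add: D_def)
  qed
  have sub: "D i \<subseteq> {\<omega> \<in> space M. y + b < psum X n \<omega>}" if "i \<in> {1..n}" for i
  proof
    fix \<omega> assume \<omega>: "\<omega> \<in> D i"
    have "(\<Sum>j\<in>{1..n} - {i}. h (X j \<omega>)) = (\<Sum>j\<in>{1..n} - {i}. X j \<omega>)"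
      using small[OF \<omega>] by (intro sum.cong) (auto simp: h_def)
    moreover have "psum X n \<omega> = X i \<omega> + (\<Sum>j\<in>{1..n} - {i}. X j \<omega>)"
      unfolding psum_def using that by (intro sum.remove) auto
    ultimately show "\<omega> \<in> {\<omega> \<in> space M. y + b < psum X n \<omega>}" using \<omega> by (auto simp: D_def)
  qed
  have D_prob: "tail y / 2 \<le> prob (D i)" if i: "i \<in> {1..n}" for i
  proof -
    let ?G = "{\<omega> \<in> space M. b \<le> (\<Sum>j\<in>{1..n} - {i}. h (X j \<omega>))}"
    let ?A = "\<Union>j\<in>{1..n}. {\<omega> \<in> space M. y < X j \<omega>}"
    let ?B = "{\<omega> \<in> space M. (\<Sum>j\<in>{1..n} - {i}. X j \<omega>) < b}"
    \<comment> \<open>The complement splits into an excess of some summand and a shortfall of the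
      sum without \<open>i\<close>; each has probability at most 1 / 4.\<close>
    have "space M - ?G \<subseteq> ?A \<union> ?B"
    proof
      fix \<omega> assume \<omega>: "\<omega> \<in> space M - ?G"
      show "\<omega> \<in> ?A \<union> ?B"
      proof (cases "\<omega> \<in> ?A")
        case False
        then have "(\<Sum>j\<in>{1..n} - {i}. h (X j \<omega>)) = (\<Sum>j\<in>{1..n} - {i}. X j \<omega>)"
          using \<omega> by (intro sum.cong) (auto simp: h_def not_less)
        then show ?thesis using \<omega> by auto
      qed auto
    qed
    then have "prob (space M - ?G) \<le> prob (?A \<union> ?B)" by (intro finite_measure_mono) auto
    also have "\<dots> \<le> prob ?A + prob ?B" by (intro measure_Un_le) auto
    also have "prob ?A \<le> (\<Sum>j\<in>{1..n}. prob {\<omega> \<in> space M. y < X j \<omega>})"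
      by (intro measure_UNION_le) auto
    also have "\<dots> = real n * tail y" by (simp add: tail_eq)
    finally have "prob (space M - ?G) \<le> 1 / 2" using assms(3) left[OF i] by linarith
    moreover have "prob (space M - ?G) = 1 - prob ?G" by (intro prob_compl) measurable
    ultimately have "1 / 2 \<le> prob ?G" by linarith
    then have "tail y * (1 / 2) \<le> tail y * prob ?G" by (intro mult_left_mono tail_nonneg)
    also have "\<dots> = prob (D i)" unfolding D_def by (rule prob_X_gt_and_sum[symmetric]) auto
    finally show ?thesis by simp
  qed
  have "real n * tail y / 2 = (\<Sum>i\<in>{1..n}. tail y / 2)" by simp
  also have "\<dots> \<le> (\<Sum>i\<in>{1..n}. prob (D i))" by (intro sum_mono D_prob)
  also have "\<dots> = prob (\<Union>i\<in>{1..n}. D i)"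
    by (rule finite_measure_finite_Union[symmetric]) (use disj in auto)
  also have "\<dots> \<le> prob {\<omega> \<in> space M. y + b < psum X n \<omega>}"
    using sub by (intro finite_measure_mono UN_least) auto
  finally show ?thesis .
qed

section \<open>Moments of order below \<open>p\<close> from the weak tail condition\<close>

lemma ex_tail_le_powr:
  assumes "0 < p" and lim: "(\<lambda>n::nat. real n * tail (real n powr (1 / p))) \<longlonglongrightarrow> 0"
  shows "\<exists>C\<ge>0. \<forall>u\<ge>1. tail u \<le> C * u powr (- p)"
proof -
  obtain B where B: "\<And>n::nat. norm (real n * tail (real n powr (1 / p))) \<le> B"
    using convergent_imp_Bseq[OF convergentI[OF lim]] by (auto simp: Bseq_def)
  have "0 \<le> B" using B[of 0] by simp
  have "tail u \<le> (2 * B) * u powr (- p)" if u: "1 \<le> u" for u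
  proof -
    \<comment> \<open>The level \<open>n powr (1 / p)\<close> lies just below \<open>u\<close>;
      rounding down costs the factor 2 in \<open>2 * B\<close>.\<close>
    define n where "n = nat \<lfloor>u powr p\<rfloor>"
    have one: "1 \<le> u powr p" using u \<open>0 < p\<close> by (simp add: ge_one_powr_ge_zero)
    have "real n = of_int \<lfloor>u powr p\<rfloor>" unfolding n_def by (intro of_nat_nat) (use one in linarith)
    moreover have "(1::int) \<le> \<lfloor>u powr p\<rfloor>" using one by (simp add: le_floor_iff)
    ultimately have n: "real n \<le> u powr p" "u powr p \<le> 2 * real n" "1 \<le> real n"
      by linarith+
    have "real n powr (1 / p) \<le> (u powr p) powr (1 / p)"
      using n \<open>0 < p\<close> by (intro powr_mono2) auto
    also have "\<dots> = u" using u \<open>0 < p\<close> by (simp add: powr_powr)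
    finally have "tail u \<le> tail (real n powr (1 / p))"
      using antimono_tail by (simp add: antimono_def)
    then have "real n * tail u \<le> real n * tail (real n powr (1 / p))"
      by (intro mult_left_mono) auto
    also have "\<dots> \<le> B" using B[of n] by simp
    finally have "real n * tail u \<le> B" .
    moreover have "u powr p * tail u \<le> 2 * real n * tail u"
      using n tail_nonneg by (intro mult_right_mono) auto
    ultimately have "u powr p * tail u \<le> 2 * B" by linarith
    then show ?thesis using u by (simp add: powr_minus field_simps)
  qed
  then show ?thesis using \<open>0 \<le> B\<close> by (intro exI[of _ "2 * B"]) auto
qed

text \<open>Dyadic decomposition: \<open>f k\<close> dominates \<open>X 0 powr q\<close> where
  \<open>X 0\<close> lies between \<open>2 ^ k\<close> and \<open>2 ^ Suc k\<close>, and its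
  integral is at most a multiple of \<open>2 powr (k * (q - p))\<close>. These bounds form a
  convergent geometric series.\<close>

lemma integrable_powr:
  assumes "0 < q" "q < p" "0 \<le> C" and C: "\<And>u. 1 \<le> u \<Longrightarrow> tail u \<le> C * u powr (- p)"
  shows "integrable M (\<lambda>\<omega>. X 0 \<omega> powr q)"
proof (rule integrableI_nonneg)
  define f where "f k \<omega> = ennreal (2 powr (real (Suc k) * q)) * indicator {\<omega> \<in> space M. 2 ^ k < X 0 \<omega>} \<omega>"
    for k \<omega>
  have [measurable]: "f k \<in> borel_measurable M" for k unfolding f_def by measurable
  have le: "ennreal (X 0 \<omega> powr q) \<le> 1 + (\<Sum>k. f k \<omega>)" if \<omega>: "\<omega> \<in> space M" for \<omega>
  proof (cases "X 0 \<omega> \<le> 1")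
    case True
    then have "X 0 \<omega> powr q \<le> 1"
      using \<omega> nonneg \<open>0 < q\<close> by (intro powr_le1) auto
    then have "ennreal (X 0 \<omega> powr q) \<le> 1" by (simp add: ennreal_le_1)
    also have "\<dots> \<le> 1 + (\<Sum>k. f k \<omega>)" by simp
    finally show ?thesis .
  next
    case False
    \<comment> \<open>The block containing \<open>X 0 \<omega>\<close> ends at the least power of 2
      not below it; its index is \<open>m - 1\<close>, where \<open>m\<close> is positive since
      \<open>X 0 \<omega> > 1\<close>.\<close>
    define m where "m = (LEAST m. X 0 \<omega> \<le> 2 ^ m)"
    obtain m' where "X 0 \<omega> < 2 ^ m'" using real_arch_pow[of 2 "X 0 \<omega>"] by auto
    then have m: "X 0 \<omega> \<le> 2 ^ m"
      unfolding m_def using LeastI[of "\<lambda>m. X 0 \<omega> \<le> 2 ^ m" m'] by simp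
    with False have "m \<noteq> 0" by (cases m) auto
    then obtain k where k: "m = Suc k" by (cases m) auto
    have "\<not> X 0 \<omega> \<le> 2 ^ k"
      using not_less_Least[of k "\<lambda>m. X 0 \<omega> \<le> 2 ^ m"] k by (simp add: m_def)
    then have fk: "f k \<omega> = ennreal (2 powr (real (Suc k) * q))"
      using \<omega> by (simp add: f_def)
    have "X 0 \<omega> powr q \<le> (2 ^ Suc k) powr q"
      using False m k \<open>0 < q\<close> by (intro powr_mono2) auto
    also have "(2 ^ Suc k :: real) = 2 powr real (Suc k)" by (rule powr_realpow[symmetric]) simp
    finally have "ennreal (X 0 \<omega> powr q) \<le> f k \<omega>"
      unfolding fk powr_powr by (rule ennreal_leI)
    also have "\<dots> = (\<Sum>j\<in>{k}. f j \<omega>)" by simp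
    also have "\<dots> \<le> (\<Sum>k. f k \<omega>)" by (intro sum_le_suminf summableI) auto
    also have "\<dots> \<le> 1 + (\<Sum>k. f k \<omega>)" by simp
    finally show ?thesis .
  qed
  define r where "r = (2::real) powr (q - p)"
  have r: "0 \<le> r" "r < 1" using \<open>q < p\<close> powr_less_mono[of "q - p" 0 2] by (auto simp: r_def)
  have fint: "integral\<^sup>N M (f k) \<le> ennreal (2 powr q * C * r ^ k)" for k
  proof -
    have "integral\<^sup>N M (f k) = ennreal (2 powr (real (Suc k) * q)) * emeasure M {\<omega> \<in> space M. 2 ^ k < X 0 \<omega>}"
      unfolding f_def by (subst nn_integral_cmult_indicator) auto
    also have "\<dots> = ennreal (2 powr (real (Suc k) * q) * tail (2 ^ k))"
      by (simp add: emeasure_eq_measure tail_def ennreal_mult)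
    also have "\<dots> \<le> ennreal (2 powr (real (Suc k) * q) * (C * (2 ^ k) powr (- p)))"
      by (intro ennreal_leI mult_left_mono C) auto
    also have "2 powr (real (Suc k) * q) * (C * (2 ^ k) powr (- p)) = 2 powr q * C * r ^ k"
    proof -
      have "(2 ^ k :: real) = 2 powr real k" by (rule powr_realpow[symmetric]) simp
      moreover have "r ^ k = 2 powr (real k * (q - p))"
        by (simp add: r_def powr_realpow[symmetric] powr_powr mult.commute)
      ultimately show ?thesis
        by (simp add: powr_powr algebra_simps flip: powr_add)
    qed
    finally show ?thesis .
  qed
  have "(\<integral>\<^sup>+\<omega>. ennreal (X 0 \<omega> powr q) \<partial>M) \<le> (\<integral>\<^sup>+\<omega>. 1 + (\<Sum>k. f k \<omega>) \<partial>M)"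
    using le by (intro nn_integral_mono)
  also have "\<dots> = 1 + (\<Sum>k. integral\<^sup>N M (f k))"
    by (simp add: nn_integral_add nn_integral_suminf emeasure_space_1)
  also have "\<dots> \<le> 1 + (\<Sum>k. ennreal (2 powr q * C * r ^ k))"
    by (intro add_left_mono suminf_le fint summableI)
  also have "(\<Sum>k. ennreal (2 powr q * C * r ^ k)) = ennreal (\<Sum>k. 2 powr q * C * r ^ k)"
    using r \<open>0 \<le> C\<close> by (intro suminf_ennreal2 summable_mult summable_geometric) auto
  also have "1 + \<dots> < \<infinity>" by simp
  finally show "(\<integral>\<^sup>+\<omega>. ennreal (X 0 \<omega> powr q) \<partial>M) < \<infinity>" .
qed auto

section \<open>Truncated moments in terms of a moment of order \<open>q\<close>\<close>

lemma trunc_square_le: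
  assumes "0 < y" "0 < q" "q \<le> 2" and int: "integrable M (\<lambda>\<omega>. X 0 \<omega> powr q)"
  shows "trunc_square y \<le> y powr (2 - q) * expectation (\<lambda>\<omega>. X 0 \<omega> powr q)"
proof -
  have "trunc_square y \<le> expectation (\<lambda>\<omega>. y powr (2 - q) * X 0 \<omega> powr q)"
    unfolding trunc_square_def using assms
    by (intro integral_mono integrable_trunc_square integrable_mult_right min_square_le_powr nonneg) auto
  then show ?thesis by simp
qed

lemma trunc_mean_le:
  assumes "0 < y" "0 < q" "q \<le> 1" and int: "integrable M (\<lambda>\<omega>. X 0 \<omega> powr q)"
  shows "trunc_mean y \<le> y powr (1 - q) * expectation (\<lambda>\<omega>. X 0 \<omega> powr q)"
proof -
  have "trunc_mean y \<le> expectation (\<lambda>\<omega>. y powr (1 - q) * X 0 \<omega> powr q)"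
    unfolding trunc_mean_def using assms
    by (intro integral_mono integrable_trunc integrable_mult_right min_le_powr nonneg) auto
  then show ?thesis by simp
qed

lemma trunc_mean_le_mean:
  assumes "0 < y" "integrable M (X 0)"
  shows "trunc_mean y \<le> expectation (X 0)"
  unfolding trunc_mean_def using assms by (intro integral_mono integrable_trunc) auto

lemma mean_le_trunc_mean:
  assumes "0 < y" "1 \<le> q" "integrable M (X 0)" and int: "integrable M (\<lambda>\<omega>. X 0 \<omega> powr q)"
  shows "expectation (X 0) \<le> trunc_mean y + y powr (1 - q) * expectation (\<lambda>\<omega>. X 0 \<omega> powr q)"
proof -
  have "expectation (\<lambda>\<omega>. X 0 \<omega> - min (X 0 \<omega>) y) \<le> expectation (\<lambda>\<omega>. y powr (1 - q) * X 0 \<omega> powr q)"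
    using assms
    by (intro integral_mono integrable_trunc integrable_mult_right diff_min_le_powr nonneg Bochner_Integration.integrable_diff) auto
  moreover have "expectation (\<lambda>\<omega>. X 0 \<omega> - min (X 0 \<omega>) y) = expectation (X 0) - trunc_mean y"
    unfolding trunc_mean_def using assms by (intro Bochner_Integration.integral_diff integrable_trunc) auto
  ultimately show ?thesis by simp
qed

end

section \<open>Sums with weakly negligible tails\<close>

text \<open>The constant \<open>m\<close> is the centring, 0 or the mean, so that both regimes of
  \<open>p\<close> share one event and one comparison of rates.\<close>

locale weak_tail = iid_nonneg +
  fixes p m s :: real
  assumes p: "0 < p" "p < 2" and s: "0 < s"
    and tail_lim: "(\<lambda>n::nat. real n * tail (real n powr (1 / p))) \<longlonglongrightarrow> 0"
    and centre: "p < 1 \<and> m = 0 \<or> 1 \<le> p \<and> integrable M (X 0) \<and> m = expectation (X 0)"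
begin

definition excess :: "nat \<Rightarrow> real" where
  "excess n = prob {\<omega> \<in> space M. real n * m + s * real n powr (1 / p) < psum X n \<omega>}"

lemma integrable_powr_less: "0 < q \<Longrightarrow> q < p \<Longrightarrow> integrable M (\<lambda>\<omega>. X 0 \<omega> powr q)"
  using ex_tail_le_powr[OF p(1) tail_lim] integrable_powr by blast

lemma tail_scaled_tendsto_0:
  assumes "1 < c"
  shows "(\<lambda>n::nat. real n * tail (real n powr (c / p))) \<longlonglongrightarrow> 0"
proof (rule tendsto_sandwich[OF _ _ tendsto_const tail_lim])
  show "\<forall>\<^sub>F n in sequentially. 0 \<le> real n * tail (real n powr (c / p))"
    by (simp add: tail_nonneg)
  show "\<forall>\<^sub>F n in sequentially. real n * tail (real n powr (c / p)) \<le> real n * tail (real n powr (1 / p))"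
    using eventually_ge_at_top[of 1]
  proof eventually_elim
    case (elim n)
    have "real n powr (1 / p) \<le> real n powr (c / p)"
      using elim assms p by (intro powr_mono divide_right_mono) auto
    then show ?case
      using antimono_tail by (intro mult_left_mono) (auto simp: antimono_def)
  qed
qed

text \<open>With \<open>y = n powr (1 / (c * p))\<close> and
  \<open>\<theta> = n powr (\<eta> - 1 / p)\<close> the first and second order terms of the exponent
  stay bounded above, while the threshold contributes \<open>- s * n powr \<eta>\<close>, whose
  exponential beats any power of \<open>n\<close>.\<close>

lemma excess_le:
  assumes c: "1 < c"
  shows "\<forall>\<^sub>F n in sequentially. excess n \<le> real n * tail (real n powr (1 / (c * p))) + real n powr (- K)"
proof -
  \<comment> \<open>\<open>g\<close> measures the room left in the exponents: the second moment
    offers \<open>2 - p\<close>, and the mean, when it is not centred, only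
    \<open>1 - p\<close>.\<close>
  define g where "g = (if p < 1 then 1 - p else 2 - p)"
  have g: "0 < g" "g \<le> 1" using p by (auto simp: g_def)
  \<comment> \<open>The bound \<open>p / 2\<close> keeps \<open>q = p - \<kappa>\<close> positive.
    The other one makes the exponents of \<open>n\<close> nonpositive in the second moment term, in
    the uncentred mean and in \<open>\<theta> * y\<close>; they lose at most
    \<open>3 * \<kappa>\<close>.\<close>
  define \<kappa> where "\<kappa> = min (p / 2) ((c - 1) * g / 3)"
  have \<kappa>: "0 < \<kappa>" "\<kappa> < p" "3 * \<kappa> \<le> (c - 1) * g" "\<kappa> \<le> (c - 1) * g / 3" using p g c by (auto simp: \<kappa>_def)
  have "(c - 1) * g \<le> c - 1" "(c - 1) * g \<le> (c - 1) * (2 - p)"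
    using g c p mult_left_mono[of g 1 "c - 1"] by (auto simp: g_def intro!: mult_left_mono)
  then have \<kappa>1: "\<kappa> \<le> c - 1" and \<kappa>2: "3 * \<kappa> \<le> (c - 1) * (2 - p)" using \<kappa> by linarith+
  have \<kappa>3: "2 * \<kappa> \<le> (c - 1) * (1 - p)" if "p < 1" using \<kappa> that by (simp add: g_def)
  define q where "q = p - \<kappa>"
  have q: "0 < q" "q < p" using \<kappa> by (auto simp: q_def)
  define E where "E = expectation (\<lambda>\<omega>. X 0 \<omega> powr q)"
  have int: "integrable M (\<lambda>\<omega>. X 0 \<omega> powr q)" using integrable_powr_less q by simp
  have E: "0 \<le> E" unfolding E_def by (intro Bochner_Integration.integral_nonneg) simp
  define d where "d = c * p"
  have d: "0 < d" using c p by (simp add: d_def)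
  define \<eta> where "\<eta> = \<kappa> / d"
  have \<eta>: "0 < \<eta>" using \<kappa> d by (simp add: \<eta>_def)
  have p_d: "1 / p = c / d" using c p by (simp add: d_def)
  have bound: "excess n \<le> real n * tail (real n powr (1 / d)) + exp (2 * E - s * real n powr \<eta>)"
    if "1 \<le> n" for n
  proof -
    have n: "1 \<le> real n" using that by simp
    define y where "y = real n powr (1 / d)"
    define \<theta> where "\<theta> = real n powr (\<eta> - 1 / p)"
    have y: "0 < y" and \<theta>: "0 < \<theta>" using n by (auto simp: y_def \<theta>_def)
    have le_1: "real n powr e \<le> 1" if "e \<le> 0" for e
      using powr_mono[OF that n] n by simp
    have "\<theta> * y = real n powr (\<eta> - 1 / p + 1 / d)" by (simp add: \<theta>_def y_def powr_add)
    also have "\<eta> - 1 / p + 1 / d = (\<kappa> - c + 1) / d"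
      unfolding p_d \<eta>_def by (simp add: add_divide_distrib diff_divide_distrib)
    also have "real n powr \<dots> \<le> 1" using \<kappa>1 d by (intro le_1 divide_nonpos_pos) auto
    finally have \<theta>y: "\<theta> * y \<le> 1" .
    have "real n * (\<theta>\<^sup>2 * trunc_square y) \<le> real n * (\<theta>\<^sup>2 * (y powr (2 - q) * E))"
      unfolding E_def using y q p int by (intro mult_left_mono trunc_square_le) auto
    also have "\<dots> = real n powr (1 + 2 * (\<eta> - 1 / p) + (2 - q) / d) * E"
    proof -
      have "\<theta>\<^sup>2 = real n powr (2 * (\<eta> - 1 / p))"
        using n by (simp add: \<theta>_def powr_power mult.commute)
      then show ?thesis using n by (simp add: y_def powr_powr powr_add)
    qed
    \<comment> \<open>Of the three \<open>\<kappa>\<close>, two come from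
      \<open>\<theta>\<^sup>2\<close> and one from \<open>q = p - \<kappa>\<close>.\<close>
    also have "1 + 2 * (\<eta> - 1 / p) + (2 - q) / d = (3 * \<kappa> - (c - 1) * (2 - p)) / d"
      unfolding p_d \<eta>_def q_def using d by (simp add: field_simps) (simp add: d_def algebra_simps)
    also have "real n powr \<dots> * E \<le> 1 * E"
      using \<kappa>2 d E by (intro mult_right_mono le_1 divide_nonpos_pos) auto
    finally have second: "real n * (\<theta>\<^sup>2 * trunc_square y) \<le> E" by simp
    \<comment> \<open>For \<open>p < 1\<close> there is no centring and the moment of order
      \<open>q\<close> controls the truncated mean; for \<open>p \<ge> 1\<close> truncation only
      lowers the mean, so the term is at most 0.\<close>
    have first: "real n * \<theta> * (trunc_mean y - m) \<le> E"
    proof (cases "p < 1")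
      case True
      then have "m = 0" using centre by auto
      have "real n * \<theta> * trunc_mean y \<le> real n * \<theta> * (y powr (1 - q) * E)"
        unfolding E_def using y \<theta> q True int by (intro mult_left_mono trunc_mean_le) auto
      also have "\<dots> = real n powr (1 + (\<eta> - 1 / p) + (1 - q) / d) * E"
        using n by (simp add: y_def \<theta>_def powr_powr powr_add)
      also have "1 + (\<eta> - 1 / p) + (1 - q) / d = (2 * \<kappa> - (c - 1) * (1 - p)) / d"
        unfolding p_d \<eta>_def q_def using d by (simp add: field_simps) (simp add: d_def algebra_simps)
      also have "real n powr \<dots> * E \<le> 1 * E"
        using \<kappa>3[OF True] d E by (intro mult_right_mono le_1 divide_nonpos_pos) auto
      finally show ?thesis using \<open>m = 0\<close> by simp
    next
      case False
      then have "trunc_mean y \<le> m" using centre trunc_mean_le_mean[OF y] by auto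
      then have "real n * \<theta> * (trunc_mean y - m) \<le> 0"
        using \<theta> by (intro mult_nonneg_nonpos) auto
      then show ?thesis using E by linarith
    qed
    define a where "a = real n * m + s * real n powr (1 / p)"
    have "\<theta> * real n powr (1 / p) = real n powr \<eta>"
      using n by (simp add: \<theta>_def flip: powr_add)
    then have "\<theta> * a = real n * \<theta> * m + s * real n powr \<eta>"
      by (simp add: a_def algebra_simps)
    then have "- \<theta> * a + real n * (\<theta> * trunc_mean y + \<theta>\<^sup>2 * trunc_square y)
        = real n * \<theta> * (trunc_mean y - m) + real n * (\<theta>\<^sup>2 * trunc_square y) - s * real n powr \<eta>"
      by (simp add: algebra_simps)
    also have "\<dots> \<le> 2 * E - s * real n powr \<eta>" using first second by linarith
    finally have "exp (- \<theta> * a + real n * (\<theta> * trunc_mean y + \<theta>\<^sup>2 * trunc_square y)) \<le> exp (2 * E - s * real n powr \<eta>)"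
      by simp
    moreover have "excess n \<le> real n * tail y + exp (- \<theta> * a + real n * (\<theta> * trunc_mean y + \<theta>\<^sup>2 * trunc_square y))"
      unfolding excess_def a_def using y \<theta> \<theta>y by (intro prob_psum_gt_le) auto
    ultimately show ?thesis unfolding y_def by linarith
  qed
  have "\<forall>\<^sub>F n::nat in sequentially. exp (2 * E - s * real n powr \<eta>) \<le> real n powr (- K)"
    using s \<eta> by real_asymp
  then show ?thesis
    using eventually_ge_at_top[of 1]
  proof eventually_elim
    case (elim n)
    then show ?case using bound[of n] by (simp add: d_def)
  qed
qed

text \<open>For \<open>p < 1\<close> the threshold is not positive and the event is empty. Otherwise
  the lower deviation bound is applied with \<open>y = n powr (c / p)\<close> and a constant value
  of \<open>\<theta> * y\<close>.\<close>

lemma left_tail_le: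
  assumes c: "1 < c"
  shows "\<forall>\<^sub>F n in sequentially. \<forall>i\<in>{1..n}.
    prob {\<omega> \<in> space M. (\<Sum>j\<in>{1..n} - {i}. X j \<omega>) < real n * m - real n powr (c / p) / 2} \<le> 1 / 4"
proof (cases "p < 1")
  case True
  then have "m = 0" using centre by auto
  have empty: "{\<omega> \<in> space M. (\<Sum>j\<in>{1..n} - {i}. X j \<omega>) < real n * m - real n powr (c / p) / 2} = {}" for n i
  proof -
    have "\<not> (\<Sum>j\<in>{1..n} - {i}. X j \<omega>) < - (real n powr (c / p) / 2)" if "\<omega> \<in> space M" for \<omega>
    proof -
      have "0 \<le> (\<Sum>j\<in>{1..n} - {i}. X j \<omega>)" using nonneg[OF that] by (intro sum_nonneg)
      then show ?thesis using powr_ge_zero[of "real n" "c / p"] by linarith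
    qed
    then show ?thesis using \<open>m = 0\<close> by auto
  qed
  show ?thesis unfolding empty by simp
next
  case False
  then have p1: "1 \<le> p" and intX: "integrable M (X 0)" and m: "m = expectation (X 0)"
    using centre by auto
  \<comment> \<open>A finite moment with \<open>c * q > p\<close> is needed. At \<open>p = 1\<close>
    the mean itself serves, with \<open>q = 1\<close>; otherwise some \<open>q\<close> strictly
    between \<open>max 1 (p / c)\<close> and \<open>p\<close> does.\<close>
  have "\<exists>q. 1 \<le> q \<and> q \<le> 2 \<and> p < c * q \<and> integrable M (\<lambda>\<omega>. X 0 \<omega> powr q)"
  proof (cases "p = 1")
    case True
    have "integrable M (\<lambda>\<omega>. X 0 \<omega> powr 1) = integrable M (X 0)"
      by (intro Bochner_Integration.integrable_cong) (auto simp: nonneg)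
    then show ?thesis using True c intX by (intro exI[of _ 1]) simp
  next
    case False
    have "p / c < p" using c p by (simp add: field_simps)
    then obtain q where "max 1 (p / c) < q" "q < p"
      using dense[of "max 1 (p / c)" p] p1 False by auto
    then show ?thesis using p c integrable_powr_less[of q] by (intro exI[of _ q]) (auto simp: field_simps)
  qed
  then obtain q where q: "1 \<le> q" "q \<le> 2" "p < c * q" and int: "integrable M (\<lambda>\<omega>. X 0 \<omega> powr q)"
    by auto
  define E where "E = expectation (\<lambda>\<omega>. X 0 \<omega> powr q)"
  have E: "0 \<le> E" unfolding E_def by (intro Bochner_Integration.integral_nonneg) simp
  have m0: "0 \<le> m" unfolding m by (intro Bochner_Integration.integral_nonneg nonneg)
  define e where "e = c / p"
  have e: "0 < e" "1 < e * q" using p c q by (auto simp: e_def field_simps)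
  \<comment> \<open>Since \<open>e * q > 1\<close>, the quantity \<open>n * y powr (- q) * E\<close>
    vanishes in the limit; the bound 1 / 144 matches
    \<open>\<theta>\<^sup>2 = 144 / y\<^sup>2\<close> below.\<close>
  have "((\<lambda>n::nat. real n powr (1 - e * q) * E) \<longlongrightarrow> 0 * E) sequentially"
    by (intro tendsto_intros tendsto_neg_powr filterlim_real_sequentially) (use e in auto)
  then have "\<forall>\<^sub>F n::nat in sequentially. real n powr (1 - e * q) * E < 1 / 144"
    by (rule order_tendstoD) simp
  moreover have "\<forall>\<^sub>F n::nat in sequentially. m \<le> real n powr e / 8"
    using e(1) by real_asymp
  ultimately show ?thesis
    using eventually_ge_at_top[of 1]
  proof eventually_elim
    case (elim n)
    define y where "y = real n powr e"
    define r where "r = real n powr (1 - e * q) * E"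
    have n: "1 \<le> real n" using elim by simp
    have y: "0 < y" using n by (simp add: y_def)
    have nyq: "real n * y powr (- q) * E = r"
      using n by (simp add: r_def y_def powr_powr powr_diff powr_minus field_simps)
    have r: "0 \<le> r" "r \<le> 1 / 144" using elim E by (auto simp: r_def)
    have my: "m \<le> y / 8" using elim by (simp add: y_def)
    \<comment> \<open>The constant 12 turns the shortfall \<open>y / 3\<close> below into the
      exponent \<open>- 4\<close>; the quadratic term gives back at most 1, leaving
      \<open>exp (- 3)\<close>.\<close>
    define \<theta> where "\<theta> = 12 / y"
    have \<theta>: "0 < \<theta>" using y by (simp add: \<theta>_def)
    define b where "b = real n * m - y / 2"
    show ?case
    proof
      fix i assume i: "i \<in> {1..n}"
      define I where "I = {1..n} - {i}"
      have card: "real (card I) = real n - 1" using i n by (simp add: I_def of_nat_diff)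
      have "real n * y powr (1 - q) * E = y * r"
        using y by (simp add: powr_diff powr_minus field_simps flip: nyq)
      moreover have "(real n - 1) * (y powr (1 - q) * E) \<le> real n * (y powr (1 - q) * E)"
        using E by (intro mult_right_mono) auto
      moreover have "(real n - 1) * m \<le> (real n - 1) * (trunc_mean y + y powr (1 - q) * E)"
        unfolding m E_def using n y q intX int by (intro mult_left_mono mean_le_trunc_mean) auto
      ultimately have "real n * m \<le> m + (real n - 1) * trunc_mean y + y * r"
        by (simp add: algebra_simps)
      moreover have "y * r \<le> y * (1 / 144)" using y r by (intro mult_left_mono) auto
      \<comment> \<open>Leaving out summand \<open>i\<close> costs one mean, at most
        \<open>y / 8\<close>, and truncation costs \<open>y * r\<close>; subtracted from
        \<open>y / 2\<close> they leave at least \<open>y / 3\<close>.\<close>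
      ultimately have "b - (real n - 1) * trunc_mean y \<le> - y / 3"
        unfolding b_def using my y by linarith
      then have "\<theta> * (b - (real n - 1) * trunc_mean y) \<le> \<theta> * (- y / 3)"
        using \<theta> by (intro mult_left_mono) auto
      also have "\<dots> = - 4" using y by (simp add: \<theta>_def)
      finally have A: "\<theta> * b - (real n - 1) * (\<theta> * trunc_mean y) \<le> - 4" by (simp add: algebra_simps)
      have "(real n - 1) * (\<theta>\<^sup>2 * trunc_square y) \<le> real n * (\<theta>\<^sup>2 * (y powr (2 - q) * E))"
        unfolding E_def using n y q int
        by (intro mult_mono mult_left_mono trunc_square_le) (auto simp: trunc_square_def intro!: mult_nonneg_nonneg)
      also have "\<dots> = 144 * r"
        using y by (simp add: \<theta>_def powr_diff powr_minus field_simps power2_eq_square flip: nyq)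
      also have "\<dots> \<le> 1" using r by simp
      finally have B: "(real n - 1) * (\<theta>\<^sup>2 * trunc_square y) \<le> 1" .
      have "prob {\<omega> \<in> space M. (\<Sum>j\<in>I. X j \<omega>) < b} \<le> prob {\<omega> \<in> space M. (\<Sum>j\<in>I. min (X j \<omega>) y) \<le> b}"
      proof (intro finite_measure_mono subsetI)
        fix \<omega> assume "\<omega> \<in> {\<omega> \<in> space M. (\<Sum>j\<in>I. X j \<omega>) < b}"
        moreover have "(\<Sum>j\<in>I. min (X j \<omega>) y) \<le> (\<Sum>j\<in>I. X j \<omega>)" by (intro sum_mono) auto
        ultimately show "\<omega> \<in> {\<omega> \<in> space M. (\<Sum>j\<in>I. min (X j \<omega>) y) \<le> b}" by auto
      qed auto
      also have "\<dots> \<le> exp (\<theta> * b - real (card I) * (\<theta> * trunc_mean y - \<theta>\<^sup>2 * trunc_square y))"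
        using y \<theta> by (intro prob_sum_trunc_le) (auto simp: I_def)
      also have "\<theta> * b - real (card I) * (\<theta> * trunc_mean y - \<theta>\<^sup>2 * trunc_square y)
          = (\<theta> * b - (real n - 1) * (\<theta> * trunc_mean y)) + (real n - 1) * (\<theta>\<^sup>2 * trunc_square y)"
        unfolding card by (simp add: algebra_simps)
      also have "exp \<dots> \<le> exp (- 3)" using A B by simp
      also have "\<dots> \<le> 1 / 4"
        using exp_ge_add_one_self[of 3] by (simp add: exp_minus field_simps)
      finally show "prob {\<omega> \<in> space M. (\<Sum>j\<in>{1..n} - {i}. X j \<omega>) < real n * m - real n powr (c / p) / 2} \<le> 1 / 4"
        by (simp add: I_def b_def y_def e_def)
    qed
  qed
qed

text \<open>A summand above \<open>y = n powr (c / p)\<close> may lose \<open>y / 2\<close> to the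
  others and still leaves \<open>y / 2\<close>, which is at least \<open>s * n powr (1 / p)\<close>
  for large \<open>n\<close>.\<close>

lemma excess_ge:
  assumes c: "1 < c"
  shows "\<forall>\<^sub>F n in sequentially. real n * tail (real n powr (c / p)) / 2 \<le> excess n"
proof -
  have "1 / p < c / p" using c p by (simp add: divide_strict_right_mono)
  then have "\<forall>\<^sub>F n::nat in sequentially. real n powr (1 / p) \<le> 1 / (2 * s) * real n powr (c / p)"
    using s by (intro eventually_powr_le_mult_powr) auto
  moreover have "\<forall>\<^sub>F n::nat in sequentially. real n * tail (real n powr (c / p)) < 1 / 4"
    using tail_scaled_tendsto_0[OF c] by (rule order_tendstoD) simp
  ultimately show ?thesis
    using left_tail_le[OF c] eventually_ge_at_top[of 1]
  proof eventually_elim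
    case (elim n)
    define y where "y = real n powr (c / p)"
    have "real n * tail y / 2 \<le> prob {\<omega> \<in> space M. y + (real n * m - y / 2) < psum X n \<omega>}"
      using elim by (intro prob_psum_gt_ge) (auto simp: y_def)
    also have "\<dots> \<le> excess n"
      unfolding excess_def
    proof (intro finite_measure_mono subsetI)
      have "s * real n powr (1 / p) \<le> y / 2" using elim(1) s by (simp add: y_def field_simps)
      then show "\<omega> \<in> {\<omega> \<in> space M. real n * m + s * real n powr (1 / p) < psum X n \<omega>}"
        if "\<omega> \<in> {\<omega> \<in> space M. y + (real n * m - y / 2) < psum X n \<omega>}" for \<omega>
        using that by auto
    qed auto
    finally show ?case by (simp add: y_def)
  qed
qed

section \<open>Identification with the rates in the theorem\<close>

lemma tail_comparison_excess: "tail_comparison tail excess p"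
  using p(1) tail_nonneg antimono_tail excess_le excess_ge
  by unfold_locales (auto simp: excess_def)

sublocale tail_comparison tail excess p
  by (rule tail_comparison_excess)

text \<open>The convention for log 0 is consistent with this: where \<open>X 0\<close> vanishes,
  neither inequality holds.\<close>

lemma tail_exp: "measure M {\<omega> \<in> space M. ereal t < elog (X 0 \<omega>)} = tail (exp t)"
proof -
  have "ereal t < elog (X 0 \<omega>) \<longleftrightarrow> exp t < X 0 \<omega>" if "\<omega> \<in> space M" for \<omega>
  proof (cases "X 0 \<omega> = 0")
    case False
    then have "0 < X 0 \<omega>" using nonneg[OF that, of 0] by simp
    then show ?thesis using exp_less_cancel_iff[of t "ln (X 0 \<omega>)"] by (simp add: elog_def)
  qed (simp add: elog_def not_less)
  then show ?thesis unfolding tail_def by (intro arg_cong[where f = "measure M"]) auto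
qed

lemma alpha_bar_eq: "alpha_bar M (X 0) = - Limsup at_top tail_rate"
  by (simp add: alpha_bar_def tail_exp tail_rate_def[abs_def])

lemma alpha_under_eq: "alpha_under M (X 0) = - Liminf at_top tail_rate"
  by (simp add: alpha_under_def tail_exp tail_rate_def[abs_def])

lemma rates:
  "limsup (\<lambda>n. elog (excess n) / ereal (ln (real n))) = - ((alpha_bar M (X 0) - ereal p) / ereal p)"
  "liminf (\<lambda>n. elog (excess n) / ereal (ln (real n))) = - ((alpha_under M (X 0) - ereal p) / ereal p)"
  "(\<lambda>n. elog (excess n) / ereal (ln (real n))) \<longlonglongrightarrow> - ((\<alpha> - ereal p) / ereal p)
    \<longleftrightarrow> alpha_bar M (X 0) = \<alpha> \<and> alpha_under M (X 0) = \<alpha>"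
  using rate_tendsto_iff[of \<alpha>] unfolding rate_def[abs_def, symmetric]
  by (simp_all add: limsup_rate liminf_rate alpha_bar_eq alpha_under_eq scale_def)

lemmas log_rates = rates[unfolded excess_def]

end

theorem theorem2p3:
  fixes M :: "'a measure" and X :: "nat \<Rightarrow> 'a \<Rightarrow> real"
  assumes "prob_space M"
    and "\<And>i. X i \<in> borel_measurable M"
    and "prob_space.indep_vars M (\<lambda>_. borel) X UNIV"
    and "\<And>i. distr M borel (X i) = distr M borel (X 0)"
    and "\<And>i \<omega>. \<omega> \<in> space M \<Longrightarrow> X i \<omega> \<ge> 0"
  shows
   "(\<forall>p::real. 0 < p \<and> p < 1 \<and>
        (\<lambda>n::nat. real n * measure M {\<omega> \<in> space M. X 0 \<omega> > real n powr (1 / p)}) \<longlonglongrightarrow> 0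
      \<longrightarrow>
        (\<forall>s>0.
           limsup (\<lambda>n::nat. elog (measure M {\<omega> \<in> space M. psum X n \<omega> > s * real n powr (1 / p)}) / ereal (ln (real n)))
             = - ((alpha_bar M (X 0) - ereal p) / ereal p)
         \<and> liminf (\<lambda>n::nat. elog (measure M {\<omega> \<in> space M. psum X n \<omega> > s * real n powr (1 / p)}) / ereal (ln (real n)))
             = - ((alpha_under M (X 0) - ereal p) / ereal p)
         \<and> (\<forall>\<alpha>::ereal. 0 \<le> \<alpha> \<longrightarrow>
              (((\<lambda>n::nat. elog (measure M {\<omega> \<in> space M. psum X n \<omega> > s * real n powr (1 / p)}) / ereal (ln (real n)))
                  \<longlonglongrightarrow> - ((\<alpha> - ereal p) / ereal p))
               \<longleftrightarrow> (alpha_bar M (X 0) = \<alpha> \<and> alpha_under M (X 0) = \<alpha>)))))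
  \<and>
   (\<forall>(p::real) (\<mu>::real). 1 \<le> p \<and> p < 2 \<and>
        integrable M (X 0) \<and> integral\<^sup>L M (X 0) = \<mu> \<and> 0 < \<mu> \<and>
        (\<lambda>n::nat. real n * measure M {\<omega> \<in> space M. X 0 \<omega> > real n powr (1 / p)}) \<longlonglongrightarrow> 0
      \<longrightarrow>
        (\<forall>s>0.
           limsup (\<lambda>n::nat. elog (measure M {\<omega> \<in> space M. psum X n \<omega> > real n * \<mu> + s * real n powr (1 / p)}) / ereal (ln (real n)))
             = - ((alpha_bar M (X 0) - ereal p) / ereal p)
         \<and> liminf (\<lambda>n::nat. elog (measure M {\<omega> \<in> space M. psum X n \<omega> > real n * \<mu> + s * real n powr (1 / p)}) / ereal (ln (real n)))
             = - ((alpha_under M (X 0) - ereal p) / ereal p)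
         \<and> (\<forall>\<alpha>::ereal. 0 \<le> \<alpha> \<longrightarrow>
              (((\<lambda>n::nat. elog (measure M {\<omega> \<in> space M. psum X n \<omega> > real n * \<mu> + s * real n powr (1 / p)}) / ereal (ln (real n)))
                  \<longlonglongrightarrow> - ((\<alpha> - ereal p) / ereal p))
               \<longleftrightarrow> (alpha_bar M (X 0) = \<alpha> \<and> alpha_under M (X 0) = \<alpha>)))))"
proof -
  interpret iid_nonneg M X
    using assms by (intro iid_nonneg.intro iid_nonneg_axioms.intro)
  \<comment> \<open>The two regimes are the instances with centring 0 and with centring at the mean;
    in the first the term \<open>n * 0\<close> disappears.\<close>
  have small: "weak_tail M X p 0 s"
    if "0 < p" "p < 1" "0 < s" "(\<lambda>n. real n * measure M {\<omega> \<in> space M. real n powr (1 / p) < X 0 \<omega>}) \<longlonglongrightarrow> 0"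
    for p s
    using that by unfold_locales (auto simp: tail_def)
  have large: "weak_tail M X p (expectation (X 0)) s"
    if "1 \<le> p" "p < 2" "0 < s" "integrable M (X 0)"
      "(\<lambda>n. real n * measure M {\<omega> \<in> space M. real n powr (1 / p) < X 0 \<omega>}) \<longlonglongrightarrow> 0" for p s
    using that by unfold_locales (auto simp: tail_def)
  show ?thesis
    using weak_tail.log_rates[OF small] weak_tail.log_rates[OF large] by simp
qed

end
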